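(* Let $X$ be the generic $n\times n$ matrix. For every $2\le k\le n-1$, the ideals $I_2(\widetilde X_{12})+\langle g_1,\ldots,g_k\rangle$ and $\langle g_{k+1}\rangle$ of $R$ intersect transversally, i.e. their intersection equals their product.
   Context: $K$ is a field, $n\ge 2$, $X=(x_{ij})$ is an $n\times n$ matrix of independent indeterminates over $K$, $Y=(y_1,\ldots,y_n)^t$ is a column of further independent indeterminates, and $R=K[x_{ij},y_j\mid 1\le i,j\le n]$. $g_r=\sum_{s=1}^n x_{rs}y_s$ is the $r$-th entry of $XY$. $\widetilde X_{12}$ is the $2\times n$ matrix consisting of the first two rows of $X$, and $I_2(\widetilde X_{12})$ is the ideal of $R$ generated by its $2\times2$ minors. *)

theory Defs
  imports
    "HOL-Library.Poly_Mapping"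
    "HOL-Algebra.Ideal_Product"
    "Jordan_Normal_Form.Determinant"
    "Jordan_Normal_Form.DL_Submatrix"
begin

text \<open>
  Following the matrix library, rows and columns are numbered from 0: \<open>XV i j\<close> and \<open>YV j\<close>
  with \<open>i, j < n\<close> stand for the indeterminates $x_{i+1,j+1}$ and $y_{j+1}$.
\<close>

datatype var = XV nat nat | YV nat

definition vars :: "nat \<Rightarrow> var set" where
  "vars n = {XV i j | i j. i < n \<and> j < n} \<union> {YV j | j. j < n}"

text \<open>Polynomials in arbitrary variables: finitely supported maps from monomials
  (finitely supported exponent functions) to coefficients.\<close>

type_synonym 'k mpoly = "(var \<Rightarrow>\<^sub>0 nat) \<Rightarrow>\<^sub>0 'k"

definition indet :: "var \<Rightarrow> 'k::field mpoly" where
  "indet v = Poly_Mapping.single (Poly_Mapping.single v 1) 1"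

text \<open>The ring $K[x_{ij}, y_j \mid 1 \le i, j \le n]$; the type \<open>var\<close> contains variables for
  every \<open>n\<close>, so the carrier restricts which of them may occur.\<close>

definition poly_ring :: "nat \<Rightarrow> 'k::field mpoly ring" where
  "poly_ring n =
    \<lparr>carrier = {p. \<forall>m\<in>Poly_Mapping.keys p. Poly_Mapping.keys m \<subseteq> vars n},
     monoid.mult = (*), one = 1, zero = 0, add = (+)\<rparr>"

definition gen_mat :: "nat \<Rightarrow> 'k::field mpoly mat" where
  "gen_mat n = mat n n (\<lambda>(i, j). indet (XV i j))"

definition gen_vec :: "nat \<Rightarrow> 'k::field mpoly vec" where
  "gen_vec n = vec n (\<lambda>j. indet (YV j))"

text \<open>The $(r+1)$-th entry of $XY$, i.e. $g_{r+1}$.\<close>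

definition XY_entry :: "nat \<Rightarrow> nat \<Rightarrow> 'k::field mpoly" where
  "XY_entry n r = (gen_mat n *\<^sub>v gen_vec n) $ r"

definition first_two_rows :: "'a mat \<Rightarrow> 'a mat" where
  "first_two_rows A = submatrix A {0, 1} UNIV"

definition minors :: "nat \<Rightarrow> 'a::comm_ring_1 mat \<Rightarrow> 'a set" where
  "minors t A = {det (submatrix A I J) | I J.
     I \<subseteq> {0..<dim_row A} \<and> card I = t \<and> J \<subseteq> {0..<dim_col A} \<and> card J = t}"

definition det_ideal :: "'a::comm_ring_1 ring \<Rightarrow> nat \<Rightarrow> 'a mat \<Rightarrow> 'a set" where
  "det_ideal R t A = Idl\<^bsub>R\<^esub> (minors t A)"

text \<open>Since \<open>Idl\<close> is an intersection of ideals of the ring, it is only meaningful for generators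
  in the carrier; the following facts confirm that this is the case here.\<close>

lemma carrier_closed:
  fixes p q :: "'k::field mpoly"
  assumes "p \<in> carrier (poly_ring n)" "q \<in> carrier (poly_ring n)"
  shows "p + q \<in> carrier (poly_ring n)" "p * q \<in> carrier (poly_ring n)"
    "- p \<in> carrier (poly_ring n)"
proof -
  show "p + q \<in> carrier (poly_ring n)"
    using assms Poly_Mapping.keys_add[of p q] by (auto simp: poly_ring_def subset_iff)
  show "- p \<in> carrier (poly_ring n)"
    using assms by (simp add: poly_ring_def)
  have "Poly_Mapping.keys m \<subseteq> vars n" if m: "m \<in> Poly_Mapping.keys (p * q)" for m
  proof -
    obtain a b where "m = a + b" "a \<in> Poly_Mapping.keys p" "b \<in> Poly_Mapping.keys q"
      using m keys_mult[of p q] by blast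
    then show ?thesis
      using assms Poly_Mapping.keys_add[of a b] by (auto simp: poly_ring_def subset_iff)
  qed
  then show "p * q \<in> carrier (poly_ring n)"
    by (simp add: poly_ring_def)
qed

lemma const_carrier:
  "0 \<in> carrier (poly_ring n)" "1 \<in> carrier (poly_ring n)"
  by (simp_all add: poly_ring_def)

lemma poly_ring_ops [simp]:
  "x \<oplus>\<^bsub>poly_ring n\<^esub> y = x + y" "x \<otimes>\<^bsub>poly_ring n\<^esub> y = x * y"
  "\<zero>\<^bsub>poly_ring n\<^esub> = 0" "\<one>\<^bsub>poly_ring n\<^esub> = 1"
  by (simp_all add: poly_ring_def)

lemma cring_poly_ring: "cring (poly_ring n :: 'k::field mpoly ring)"
proof (rule cringI)
  show "abelian_group (poly_ring n :: 'k mpoly ring)"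
  proof (rule abelian_groupI)
    fix x :: "'k mpoly"
    assume x: "x \<in> carrier (poly_ring n)"
    show "\<exists>y\<in>carrier (poly_ring n). y \<oplus>\<^bsub>poly_ring n\<^esub> x = \<zero>\<^bsub>poly_ring n\<^esub>"
      by (rule bexI[OF _ carrier_closed(3)[OF x x]]) simp
  qed (simp_all add: carrier_closed const_carrier add_ac)
  show "Group.comm_monoid (poly_ring n :: 'k mpoly ring)"
    by (rule comm_monoidI) (simp_all add: carrier_closed const_carrier mult_ac)
qed (simp add: distrib_right)

lemma indet_carrier: "v \<in> vars n \<Longrightarrow> indet v \<in> carrier (poly_ring n)"
  by (simp add: indet_def poly_ring_def)

lemma sum_carrier:
  fixes f :: "'i \<Rightarrow> 'k::field mpoly"
  assumes "\<And>i. i \<in> A \<Longrightarrow> f i \<in> carrier (poly_ring n)"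
  shows "sum f A \<in> carrier (poly_ring n)"
  using assms
  by (induction A rule: infinite_finite_induct) (simp_all add: carrier_closed const_carrier)

lemma prod_carrier:
  fixes f :: "'i \<Rightarrow> 'k::field mpoly"
  assumes "\<And>i. i \<in> A \<Longrightarrow> f i \<in> carrier (poly_ring n)"
  shows "prod f A \<in> carrier (poly_ring n)"
  using assms
  by (induction A rule: infinite_finite_induct) (simp_all add: carrier_closed const_carrier)

lemma XY_entry_eq: "r < n \<Longrightarrow> XY_entry n r = (\<Sum>s<n. indet (XV r s) * indet (YV s))"
  by (simp add: XY_entry_def gen_mat_def gen_vec_def scalar_prod_def atLeast0LessThan)

lemma XY_entry_carrier: "r < n \<Longrightarrow> XY_entry n r \<in> carrier (poly_ring n)"
  by (auto simp: XY_entry_eq vars_def intro!: sum_carrier carrier_closed(2) indet_carrier)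

lemma det_carrier:
  fixes A :: "'k::field mpoly mat"
  assumes "\<And>i j. i < dim_row A \<Longrightarrow> j < dim_col A \<Longrightarrow> A $$ (i, j) \<in> carrier (poly_ring n)"
  shows "det A \<in> carrier (poly_ring n)"
proof (cases "dim_row A = dim_col A")
  case True
  have "signof p * (\<Prod>i = 0..<dim_row A. A $$ (i, p i)) \<in> carrier (poly_ring n)"
    if "p permutes {0..<dim_row A}" for p
  proof (rule carrier_closed(2))
    show "(\<Prod>i = 0..<dim_row A. A $$ (i, p i)) \<in> carrier (poly_ring n)"
      using that True by (intro prod_carrier assms) (auto dest: permutes_in_image)
    have "(1::'k mpoly) \<in> carrier (poly_ring n)"
      by (simp add: poly_ring_def)
    then show "(signof p :: 'k mpoly) \<in> carrier (poly_ring n)"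
      using carrier_closed(3) by (auto simp: sign_def)
  qed
  then show ?thesis
    using True by (auto simp: det_def intro!: sum_carrier)
qed (simp add: det_def poly_ring_def)

lemma submatrix_entry:
  assumes "i < dim_row (submatrix A I J)" "j < dim_col (submatrix A I J)"
  shows "\<exists>i' j'. i' < dim_row A \<and> j' < dim_col A \<and> submatrix A I J $$ (i, j) = A $$ (i', j')"
proof -
  have ij: "i < card {i. i < dim_row A \<and> i \<in> I}" "j < card {j. j < dim_col A \<and> j \<in> J}"
    using assms by (simp_all add: dim_submatrix)
  show ?thesis
    using pick_le[OF ij(1)] pick_le[OF ij(2)] submatrix_index[OF ij] by blast
qed

lemma minors_carrier:
  "minors t (first_two_rows (gen_mat n)) \<subseteq> carrier (poly_ring n :: 'k::field mpoly ring)"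
proof -
  have entry: "gen_mat n $$ (i, j) \<in> carrier (poly_ring n :: 'k mpoly ring)"
    if "i < dim_row (gen_mat n :: 'k mpoly mat)" "j < dim_col (gen_mat n :: 'k mpoly mat)" for i j
    using that by (auto simp: gen_mat_def vars_def intro!: indet_carrier)
  have sub: "submatrix A I J $$ (i, j) \<in> carrier (poly_ring n)"
    if "\<And>i j. i < dim_row A \<Longrightarrow> j < dim_col A \<Longrightarrow> A $$ (i, j) \<in> carrier (poly_ring n)"
      "i < dim_row (submatrix A I J)" "j < dim_col (submatrix A I J)"
    for A :: "'k mpoly mat" and I J i j
    using that submatrix_entry[of i A I J j] by metis
  show ?thesis
    unfolding minors_def first_two_rows_def by (auto intro!: det_carrier sub entry)
qed

end

theory Submission
  imports Defs
begin

text \<open>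
  Because \<open>\<langle>g\<rangle>\<close> is principal, the claim says that \<open>g = XY_entry n k\<close> is a non-zero-divisor modulo the
  ideal \<open>J\<close> generated by the minors of the first two rows and by the entries \<open>g\<^sub>0, \<dots>, g\<^sub>k\<^sub>-\<^sub>1\<close> of \<open>XY\<close>
  (numbered from 0): if \<open>p * g \<in> J\<close> then \<open>p \<in> J\<close>. Two ideas give this.

  The first idea removes the minors. They vanish exactly when one row is a multiple of the other, so
  the first two rows are replaced by \<open>(u\<^sub>0, \<dots>)\<close> and \<open>(b u\<^sub>0, \<dots>)\<close>. This substitution \<open>specialize\<close>
  sends monomials to monomials, sends \<open>g\<^sub>0\<close> to itself and \<open>g\<^sub>1\<close> to \<open>b g\<^sub>0\<close>, and fixes the other
  entries; hence it maps \<open>J\<close> into the ideal generated by the \<open>g\<^sub>i\<close> with \<open>i < k\<close>, \<open>i \<noteq> 1\<close>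
  (\<open>mem_imp_specialize_mem\<close>). Conversely, a polynomial that lands in this ideal lies in \<open>J\<close>
  (\<open>specialize_mem_imp_mem\<close>). For this, choose for every monomial in the image a preimage, and map
  all other monomials to 0. The resulting linear map undoes \<open>specialize\<close> modulo \<open>J\<close>, since two
  monomials with the same image are congruent modulo the minors (\<open>collapse_eq_imp_cong\<close>), and it
  carries multiples of \<open>g\<^sub>i\<close> back into \<open>J\<close>: in the critical case \<open>i = 0\<close>, a monomial times \<open>g\<^sub>0\<close> can
  meet the image either because the monomial is in the image, or because it has one factor \<open>b\<close>
  too many, and then \<open>b g\<^sub>0\<close> comes from \<open>g\<^sub>1\<close> (\<open>section_mult_XY_entry\<close>).

  It remains to see that the entries of \<open>XY\<close> form a regular sequence in every order
  (\<open>XY_entries_regular\<close>). Grade the polynomials by the degree in the diagonal variables. The leading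
  form of \<open>g\<^sub>i\<close> is the monomial \<open>x\<^sub>i\<^sub>i y\<^sub>i\<close>, and these monomials are pairwise coprime. So every
  monomial is uniquely a product of powers of the \<open>x\<^sub>i\<^sub>i y\<^sub>i\<close> and of a monomial divisible by none of them;
  replacing each \<open>x\<^sub>i\<^sub>i y\<^sub>i\<close> by \<open>g\<^sub>i\<close> in this product gives a linear map that is unipotent for the
  grading, hence bijective. It turns multiplication by \<open>x\<^sub>i\<^sub>i y\<^sub>i\<close> into multiplication by \<open>g\<^sub>i\<close>, and for
  pairwise coprime monomials the statement is immediate.
\<close>

section \<open>Linear extension\<close>

abbreviation lookup :: "('a \<Rightarrow>\<^sub>0 'b::zero) \<Rightarrow> 'a \<Rightarrow> 'b" where
  "lookup \<equiv> Poly_Mapping.lookup"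

abbreviation keys :: "('a \<Rightarrow>\<^sub>0 'b::zero) \<Rightarrow> 'a set" where
  "keys \<equiv> Poly_Mapping.keys"

abbreviation term_of :: "'m \<Rightarrow> 'a::zero \<Rightarrow> 'm \<Rightarrow>\<^sub>0 'a" where
  "term_of \<equiv> Poly_Mapping.single"

lemma terms_induct [case_names zero monomial add]:
  fixes p :: "'m \<Rightarrow>\<^sub>0 'a::comm_monoid_add"
  assumes "P 0" and "\<And>e c. e \<in> keys p \<Longrightarrow> P (term_of e c)" and "\<And>p q. P p \<Longrightarrow> P q \<Longrightarrow> P (p + q)"
  shows "P p"
proof -
  have "P (\<Sum>e\<in>A. term_of e (lookup p e))" if "finite A" "A \<subseteq> keys p" for A
    using that by (induction A rule: finite_induct) (auto intro: assms)
  moreover have "p = (\<Sum>e\<in>keys p. term_of e (lookup p e))"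
    by (rule poly_mapping_eqI)
      (auto simp: lookup_sum lookup_single when_def in_keys_iff sum.delta)
  ultimately show ?thesis
    by (metis finite_keys order_refl)
qed

text \<open>
  All maps below are given by their values on monomials; some are ring homomorphisms, others are only
  linear.
\<close>

definition lin_ext :: "('m \<Rightarrow> 'n::comm_monoid_add \<Rightarrow>\<^sub>0 'a::comm_ring_1) \<Rightarrow> ('m \<Rightarrow>\<^sub>0 'a) \<Rightarrow> 'n \<Rightarrow>\<^sub>0 'a" where
  "lin_ext f p = (\<Sum>e\<in>keys p. term_of 0 (lookup p e) * f e)"

lemma lin_ext_term [simp]: "lin_ext f (term_of e c) = term_of 0 c * f e"
  by (simp add: lin_ext_def)

lemma lin_ext_zero [simp]: "lin_ext f 0 = 0"
  by (simp add: lin_ext_def)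

lemma lin_ext_add: "lin_ext f (p + q) = lin_ext f p + lin_ext f q"
  unfolding lin_ext_def
  by (rule setsum_keys_plus_distrib[where f = "\<lambda>e c. term_of 0 c * f e"])
    (simp_all add: single_add distrib_right)

lemma lin_ext_diff: "lin_ext f (p - q) = lin_ext f p - lin_ext f q"
  using lin_ext_add[of f "p - q" q] by simp

lemma lin_ext_sum: "lin_ext f (\<Sum>i\<in>A. p i) = (\<Sum>i\<in>A. lin_ext f (p i))"
  by (induction A rule: infinite_finite_induct) (simp_all add: lin_ext_add)

lemma lin_ext_mult:
  fixes f :: "'m::comm_monoid_add \<Rightarrow> 'n::comm_monoid_add \<Rightarrow>\<^sub>0 'a::comm_ring_1"
  assumes "\<And>d e. f (d + e) = f d * f e"
  shows "lin_ext f (p * q) = lin_ext f p * lin_ext f q"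
proof (induction p rule: terms_induct)
  case (monomial d a)
  show ?case
  proof (induction q rule: terms_induct)
    case (monomial e b)
    have "term_of 0 (a * b) = term_of (0::'n) a * term_of 0 b"
      by (simp add: mult_single)
    then show ?case by (simp add: mult_single assms mult_ac)
  qed (simp_all add: lin_ext_add algebra_simps)
qed (simp_all add: lin_ext_add algebra_simps)

text \<open>
  This is how a linear map that is not multiplicative can still turn multiplication by one fixed
  monomial into multiplication by a fixed polynomial.
\<close>

lemma lin_ext_shift:
  fixes f :: "'m::comm_monoid_add \<Rightarrow> 'n::comm_monoid_add \<Rightarrow>\<^sub>0 'a::comm_ring_1"
  assumes "\<And>e. f (d + e) = g * f e"
  shows "lin_ext f (term_of d 1 * p) = g * lin_ext f p"
  by (induction p rule: terms_induct)
    (simp_all add: lin_ext_add mult_single assms mult.left_commute distrib_left)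

section \<open>Leading monomials for the degree in the diagonal variables\<close>

definition diag_deg :: "nat \<Rightarrow> (var \<Rightarrow>\<^sub>0 nat) \<Rightarrow> nat" where
  "diag_deg n e = (\<Sum>i<n. lookup e (XV i i))"

lemma diag_deg_add: "diag_deg n (d + e) = diag_deg n d + diag_deg n e"
  by (simp add: diag_deg_def lookup_add sum.distrib)

text \<open>
  The part of top degree is required to be a single monomial with coefficient 1. This makes
  the linear extension of a map with \<open>has_lead n e (f e)\<close> unipotent.
\<close>

definition has_lead :: "nat \<Rightarrow> (var \<Rightarrow>\<^sub>0 nat) \<Rightarrow> 'k::field mpoly \<Rightarrow> bool" where
  "has_lead n e p \<longleftrightarrow> (\<forall>d\<in>keys (p - term_of e 1). diag_deg n d < diag_deg n e)"

lemma has_lead_term: "has_lead n e (term_of e 1)"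
  by (simp add: has_lead_def)

lemma has_lead_mult:
  assumes p: "has_lead n d p" and q: "has_lead n e q"
  shows "has_lead n (d + e) (p * q)"
  unfolding has_lead_def
proof
  fix m assume m: "m \<in> keys (p * q - term_of (d + e) 1)"
  define p' where "p' = p - term_of d 1"
  define q' where "q' = q - term_of e 1"
  have "p * q - term_of (d + e) 1 = p' * q' + p' * term_of e 1 + term_of d 1 * q'"
    by (simp add: p'_def q'_def algebra_simps mult_single)
  then have "m \<in> keys (p' * q') \<union> keys (p' * term_of e 1) \<union> keys (term_of d 1 * q')"
    using m keys_add by (metis (no_types, opaque_lifting) UnCI UnE subsetD)
  moreover have "keys (p' * q') \<subseteq> {a + b | a b. a \<in> keys p' \<and> b \<in> keys q'}"
    "keys (p' * term_of e 1) \<subseteq> {a + e | a. a \<in> keys p'}"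
    "keys (term_of d 1 * q') \<subseteq> {d + b | b. b \<in> keys q'}"
    using keys_mult[of p' q'] keys_mult[of p' "term_of e 1"] keys_mult[of "term_of d 1" q'] by auto
  moreover have "\<And>a. a \<in> keys p' \<Longrightarrow> diag_deg n a < diag_deg n d"
    "\<And>b. b \<in> keys q' \<Longrightarrow> diag_deg n b < diag_deg n e"
    using p q by (auto simp: has_lead_def p'_def q'_def)
  ultimately show "diag_deg n m < diag_deg n (d + e)"
    by (fastforce simp: diag_deg_add)
qed

lemma has_lead_prod:
  assumes "\<And>i. i \<in> A \<Longrightarrow> has_lead n (e i) (p i)"
  shows "has_lead n (\<Sum>i\<in>A. e i) (\<Prod>i\<in>A. p i)"
  using assms
proof (induction A rule: infinite_finite_induct)
  case (insert i A)
  then show ?case by (simp add: has_lead_mult)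
qed (use has_lead_term[of n 0] in simp_all)

text \<open>A monomial of maximal degree in \<open>p\<close> cannot be cancelled by the images of the others.\<close>

lemma lin_ext_lead_inj:
  assumes f: "\<And>e. has_lead n e (f e)" and 0: "lin_ext f p = 0"
  shows "p = 0"
proof (rule ccontr)
  assume "p \<noteq> 0"
  then have ne: "keys p \<noteq> {}" by simp
  have "Max (diag_deg n ` keys p) \<in> diag_deg n ` keys p"
    using ne by (intro Max_in) auto
  then obtain e where e: "e \<in> keys p" and "diag_deg n e = Max (diag_deg n ` keys p)"
    by (metis imageE)
  then have max: "diag_deg n d \<le> diag_deg n e" if "d \<in> keys p" for d
    using that by simp
  have low: "lookup (f d - term_of d 1) e = 0" if "d \<in> keys p" for d
    using f[of d] max[OF that] by (metis has_lead_def leD lookup_not_eq_zero_eq_in_keys)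
  have "lookup (f d) e = (1 when d = e)" if "d \<in> keys p" for d
    using low[OF that] by (simp add: lookup_minus lookup_single)
  note f_e = this
  have "lookup (lin_ext f p) e = (\<Sum>d\<in>keys p. lookup p d * lookup (f d) e)"
    by (simp add: lin_ext_def lookup_sum mult_map_scale_conv_mult[symmetric] map.rep_eq when_def)
      (auto intro: sum.cong)
  also have "\<dots> = (\<Sum>d\<in>keys p. if e = d then lookup p d else 0)"
    by (intro sum.cong) (auto simp: f_e)
  also have "\<dots> = lookup p e"
    using e by simp
  finally show False
    using e 0 by (simp add: in_keys_iff)
qed

text \<open>Subtracting \<open>lin_ext f p\<close> from \<open>p\<close> lowers the degree, so the induction terminates.\<close>

lemma lin_ext_lead_surj:
  fixes f :: "(var \<Rightarrow>\<^sub>0 nat) \<Rightarrow> 'k::field mpoly"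
  assumes f: "\<And>e. has_lead n e (f e)"
  obtains q where "p = lin_ext f q"
proof -
  have "\<exists>q. p = lin_ext f q" if "\<And>e. e \<in> keys p \<Longrightarrow> diag_deg n e < b" for b p
    using that
  proof (induction b arbitrary: p)
    case 0
    then have "keys p = {}" by blast
    then have "p = lin_ext f 0" by simp
    then show ?case ..
  next
    case (Suc b)
    define r where "r = lin_ext f p - p"
    have "p = (\<Sum>e\<in>keys p. term_of 0 (lookup p e) * term_of e 1)"
      by (rule poly_mapping_eqI)
        (auto simp: lookup_sum lookup_single mult_single when_def in_keys_iff sum.delta)
    then have r: "r = (\<Sum>e\<in>keys p. term_of 0 (lookup p e) * (f e - term_of e 1))"
      unfolding r_def lin_ext_def
      by (metis (no_types, lifting) right_diff_distrib sum.cong sum_subtractf)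
    have "diag_deg n d < b" if "d \<in> keys r" for d
    proof -
      have "d \<in> (\<Union>e\<in>keys p. keys (term_of 0 (lookup p e) * (f e - term_of e 1)))"
        using that unfolding r by (rule subsetD[OF keys_sum])
      then obtain e where e: "e \<in> keys p"
        and d: "d \<in> keys (term_of 0 (lookup p e) * (f e - term_of e 1))"
        by blast
      have "d \<in> keys (f e - term_of e 1)"
        using d keys_mult[of "term_of 0 (lookup p e)" "f e - term_of e 1"]
        by (auto split: if_splits)
      then have "diag_deg n d < diag_deg n e"
        using f[of e] by (auto simp: has_lead_def)
      then show ?thesis using Suc.prems[OF e] by linarith
    qed
    then obtain q where "r = lin_ext f q" using Suc.IH by blast
    then have "p = lin_ext f (p - q)" by (simp add: r_def lin_ext_diff algebra_simps)
    then show ?case ..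
  qed
  moreover have "diag_deg n e < Suc (Max (diag_deg n ` keys p))" if "e \<in> keys p" for e
    using that by (simp add: less_Suc_eq_le)
  ultimately show ?thesis
    using that by blast
qed

section \<open>The entries of \<open>XY\<close> form a regular sequence in every order\<close>

abbreviation diag_pow :: "nat \<Rightarrow> nat \<Rightarrow> var \<Rightarrow>\<^sub>0 nat" where
  "diag_pow i c \<equiv> term_of (XV i i) c + term_of (YV i) c"

definition diag_pair :: "nat \<Rightarrow> var \<Rightarrow>\<^sub>0 nat" where
  "diag_pair i = diag_pow i 1"

text \<open>The exponent of \<open>x\<^sub>i\<^sub>i y\<^sub>i\<close> in a monomial: the largest power that divides it.\<close>

definition diag_mult :: "(var \<Rightarrow>\<^sub>0 nat) \<Rightarrow> nat \<Rightarrow> nat" where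
  "diag_mult e i = min (lookup e (XV i i)) (lookup e (YV i))"

text \<open>
  Every factor \<open>x\<^sub>i\<^sub>i y\<^sub>i\<close> of the monomial is replaced by the entry of \<open>XY\<close> whose leading monomial it
  is.
\<close>

definition std_product :: "nat \<Rightarrow> (var \<Rightarrow>\<^sub>0 nat) \<Rightarrow> 'k::field mpoly" where
  "std_product n e = (\<Prod>i<n. XY_entry n i ^ diag_mult e i) *
     term_of (e - (\<Sum>i<n. diag_pow i (diag_mult e i))) 1"

lemma lookup_sum_diag_pow:
  "lookup (\<Sum>i<n. diag_pow i (c i)) (XV a b) = (if a = b \<and> a < n then c a else 0)"
  "lookup (\<Sum>i<n. diag_pow i (c i)) (YV b) = (if b < n then c b else 0)"
  by (auto simp: lookup_sum lookup_add lookup_single when_def sum.delta)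

lemma lookup_diag_pair:
  "lookup (diag_pair r) (XV a b) = (if a = r \<and> b = r then 1 else 0)"
  "lookup (diag_pair r) (YV b) = (if b = r then 1 else 0)"
  by (auto simp: diag_pair_def lookup_add lookup_single when_def)

text \<open>In row \<open>i\<close>, the only diagonal variable is \<open>x\<^sub>i\<^sub>i\<close>.\<close>

lemma XY_entry_has_lead:
  assumes "i < n"
  shows "has_lead n (diag_pair i) (XY_entry n i)"
  unfolding has_lead_def
proof
  fix d assume d: "d \<in> keys (XY_entry n i - term_of (diag_pair i) 1 :: 'a mpoly)"
  let ?m = "\<lambda>s. Poly_Mapping.single (XV i s) 1 + Poly_Mapping.single (YV s) (1::nat)"
  have "XY_entry n i = (\<Sum>s<n. term_of (?m s) (1::'a))"
    using assms by (simp add: XY_entry_eq indet_def mult_single)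
  also have "\<dots> = term_of (diag_pair i) 1 + (\<Sum>s\<in>{..<n} - {i}. term_of (?m s) 1)"
    using assms by (simp add: diag_pair_def sum.remove)
  finally have "d \<in> keys (\<Sum>s\<in>{..<n} - {i}. term_of (?m s) (1::'a))"
    using d by simp
  then obtain s where "s \<noteq> i" "d = ?m s"
    using keys_sum by fastforce
  then have "diag_deg n d = 0"
    by (auto simp: diag_deg_def lookup_add lookup_single when_def)
  moreover have "diag_deg n (diag_pair i) = 1"
    using assms by (simp add: diag_deg_def diag_pair_def lookup_add lookup_single when_def)
  ultimately show "diag_deg n d < diag_deg n (diag_pair i)" by simp
qed

lemma diag_pow_Suc: "diag_pow i (Suc c) = diag_pair i + diag_pow i c"
  by (rule poly_mapping_eqI) (simp add: diag_pair_def lookup_add lookup_single when_def)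

lemma std_product_has_lead: "has_lead n e (std_product n e)"
proof -
  have pow: "has_lead n (diag_pow i c) (XY_entry n i ^ c)" if "i < n" for i c
  proof (induction c)
    case 0
    then show ?case using has_lead_term[of n 0] by (simp add: diag_pair_def)
  next
    case (Suc c)
    then show ?case
      using has_lead_mult[OF XY_entry_has_lead[OF that] Suc] by (simp only: diag_pow_Suc power_Suc)
  qed
  let ?d = "\<Sum>i<n. diag_pow i (diag_mult e i)"
  have "lookup (?d + (e - ?d)) v = lookup e v" for v
    by (cases v) (auto simp: lookup_add lookup_minus lookup_sum_diag_pow diag_mult_def)
  then have "?d + (e - ?d) = e"
    by (rule poly_mapping_eqI)
  moreover have "has_lead n (?d + (e - ?d)) (std_product n e)"
    unfolding std_product_def by (intro has_lead_mult has_lead_prod has_lead_term pow) simp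
  ultimately show ?thesis by simp
qed

text \<open>
  Multiplying by \<open>x\<^sub>r\<^sub>r y\<^sub>r\<close> changes only the exponent of this product, and not the complementary
  monomial, because the pairs \<open>x\<^sub>i\<^sub>i y\<^sub>i\<close> have no variables in common.
\<close>

lemma std_product_shift:
  assumes "r < n"
  shows "std_product n (diag_pair r + e) = XY_entry n r * std_product n e"
proof -
  have mult: "diag_mult (diag_pair r + e) i = (if i = r then 1 else 0) + diag_mult e i" for i
    by (simp add: diag_mult_def diag_pair_def lookup_add lookup_single when_def)
  have le: "diag_mult e i \<le> lookup e (XV i i)" "diag_mult e i \<le> lookup e (YV i)" for i
    by (simp_all add: diag_mult_def)
  have "lookup (diag_pair r + e - (\<Sum>i<n. diag_pow i (diag_mult (diag_pair r + e) i))) v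
      = lookup (e - (\<Sum>i<n. diag_pow i (diag_mult e i))) v" for v
    using assms
    by (cases v)
      (auto simp: lookup_add lookup_minus lookup_sum_diag_pow mult lookup_diag_pair)
  then have "diag_pair r + e - (\<Sum>i<n. diag_pow i (diag_mult (diag_pair r + e) i))
      = e - (\<Sum>i<n. diag_pow i (diag_mult e i))"
    by (rule poly_mapping_eqI)
  moreover have "(\<Prod>i<n. XY_entry n i ^ diag_mult (diag_pair r + e) i)
      = XY_entry n r * (\<Prod>i<n. XY_entry n i ^ diag_mult e i :: 'a mpoly)"
  proof -
    have "XY_entry n i ^ (if i = r then 1 else 0) = (if i = r then XY_entry n r else 1 :: 'a mpoly)" for i
      by simp
    then show ?thesis
      using assms by (simp only: mult power_add prod.distrib) simp
  qed
  ultimately show ?thesis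
    by (simp add: std_product_def mult.assoc)
qed

lemma lookup_term_mult:
  fixes p :: "'m::cancel_comm_monoid_add \<Rightarrow>\<^sub>0 'a::comm_ring_1"
  shows "lookup (term_of d 1 * p) (d + e) = lookup p e"
  by (induction p rule: terms_induct)
    (simp_all add: mult_single lookup_single lookup_add distrib_left)

text \<open>
  Transport along the bijection \<open>lin_ext (std_product n)\<close> replaces the entries of \<open>XY\<close> by the pairwise
  coprime monomials \<open>x\<^sub>i\<^sub>i y\<^sub>i\<close>. If \<open>x\<^sub>r\<^sub>r y\<^sub>r m\<close> is divisible by \<open>x\<^sub>i\<^sub>i y\<^sub>i\<close> with \<open>i \<noteq> r\<close>, so is \<open>m\<close>.
\<close>

lemma XY_entries_regular:
  fixes p :: "'k::field mpoly"
  assumes r: "r < n" and S: "S \<subseteq> {..<n}" "r \<notin> S"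
    and eq: "p * XY_entry n r = (\<Sum>i\<in>S. q i * XY_entry n i)"
  obtains q' where "p = (\<Sum>i\<in>S. q' i * XY_entry n i)"
proof -
  have finS: "finite S" using S(1) finite_subset by blast
  let ?F = "lin_ext (std_product n) :: 'k mpoly \<Rightarrow> 'k mpoly"
  have shift: "?F (term_of (diag_pair i) 1 * u) = XY_entry n i * ?F u" if "i < n" for i u
    by (intro lin_ext_shift std_product_shift that)
  obtain p' where p': "p = ?F p'"
    using lin_ext_lead_surj[OF std_product_has_lead] by blast
  have "\<forall>i. \<exists>u. q i = ?F u"
    using lin_ext_lead_surj[OF std_product_has_lead] by blast
  then obtain q' where q': "\<And>i. q i = ?F (q' i)" by metis
  have "?F (term_of (diag_pair r) 1 * p' - (\<Sum>i\<in>S. term_of (diag_pair i) 1 * q' i))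
      = XY_entry n r * p - (\<Sum>i\<in>S. XY_entry n i * q i)"
  proof -
    have "(\<Sum>i\<in>S. ?F (term_of (diag_pair i) 1 * q' i)) = (\<Sum>i\<in>S. XY_entry n i * q i)"
      using S(1) by (intro sum.cong refl) (auto simp: shift q')
    then show ?thesis
      by (simp add: lin_ext_diff lin_ext_sum shift[OF r] p')
  qed
  also have "\<dots> = 0"
    using eq by (simp add: mult.commute)
  finally have "term_of (diag_pair r) 1 * p' - (\<Sum>i\<in>S. term_of (diag_pair i) 1 * q' i) = 0"
    by (rule lin_ext_lead_inj[OF std_product_has_lead])
  then have eq': "term_of (diag_pair r) 1 * p' = (\<Sum>i\<in>S. term_of (diag_pair i) 1 * q' i)"
    by simp
  have "\<exists>u. ?F p' = (\<Sum>i\<in>S. u i * XY_entry n i)"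
  proof (induction p' rule: terms_induct)
    case zero
    show ?case by (intro exI[of _ "\<lambda>_. 0"]) simp
  next
    case (monomial e c)
    then have "diag_pair r + e \<in> keys (term_of (diag_pair r) 1 * p')"
      by (simp add: in_keys_iff lookup_term_mult)
    then have "diag_pair r + e \<in> (\<Union>i\<in>S. keys (term_of (diag_pair i) 1 * q' i))"
      unfolding eq' by (rule subsetD[OF keys_sum])
    then obtain i where i: "i \<in> S"
      and "diag_pair r + e \<in> keys (term_of (diag_pair i) 1 * q' i)"
      by blast
    then obtain d where d: "diag_pair r + e = diag_pair i + d"
      using keys_mult[of "term_of (diag_pair i) 1" "q' i"] by auto
    have "i \<noteq> r" using i S by blast
    then have "lookup (diag_pair i + (e - diag_pair i)) v = lookup e v" for v
      using arg_cong[OF d, of "\<lambda>e. lookup e v"]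
      by (auto simp: diag_pair_def lookup_add lookup_minus lookup_single when_def split: if_splits)
    then have "e = diag_pair i + (e - diag_pair i)"
      by (metis poly_mapping_eqI)
    then have "?F (term_of e c) = XY_entry n i * ?F (term_of (e - diag_pair i) c)"
      using shift[of i "term_of (e - diag_pair i) c"] i S(1) by (auto simp: mult_single)
    also have "\<dots> = (\<Sum>j\<in>S. if j = i then XY_entry n i * ?F (term_of (e - diag_pair i) c) else 0)"
      using i finS by simp
    also have "\<dots> = (\<Sum>j\<in>S. (if j = i then ?F (term_of (e - diag_pair i) c) else 0) * XY_entry n j)"
      by (intro sum.cong) (auto simp: mult.commute)
    finally show ?case by (intro exI)
  next
    case (add a b)
    then obtain u v where "?F a = (\<Sum>i\<in>S. u i * XY_entry n i)" "?F b = (\<Sum>i\<in>S. v i * XY_entry n i)"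
      by blast
    then show ?case
      by (intro exI[of _ "\<lambda>i. u i + v i"]) (simp add: lin_ext_add sum.distrib distrib_right)
  qed
  then show ?thesis using that p' by blast
qed

section \<open>Making the first two rows proportional\<close>

text \<open>
  On exponents, this is the substitution \<open>x\<^sub>1\<^sub>j \<mapsto> b x\<^sub>0\<^sub>j\<close>. As the variables of row 1 do not survive it,
  \<open>x\<^sub>1\<^sub>0\<close> is free to play the role of the new variable \<open>b\<close>.
\<close>

definition collapse :: "nat \<Rightarrow> (var \<Rightarrow>\<^sub>0 nat) \<Rightarrow> var \<Rightarrow>\<^sub>0 nat" where
  "collapse n e = Poly_Mapping.mapp (\<lambda>v c. if \<exists>j. v = XV 1 j then 0 else c) e +
     (\<Sum>j<n. term_of (XV 0 j) (lookup e (XV 1 j)) + term_of (XV 1 0) (lookup e (XV 1 j)))"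

lemma lookup_collapse:
  "lookup (collapse n e) (XV 0 j) = lookup e (XV 0 j) + (if j < n then lookup e (XV 1 j) else 0)"
  "lookup (collapse n e) (XV (Suc 0) j) = (if j = 0 then \<Sum>i<n. lookup e (XV 1 i) else 0)"
  "lookup (collapse n e) (XV (Suc (Suc i)) j) = lookup e (XV (Suc (Suc i)) j)"
  "lookup (collapse n e) (YV j) = lookup e (YV j)"
  by (auto simp: collapse_def lookup_add lookup_sum lookup_single when_def in_keys_iff
      sum.distrib Poly_Mapping.mapp.rep_eq)

lemma var_cases:
  obtains j where "v = XV 0 j" | j where "v = XV (Suc 0) j"
    | i j where "v = XV (Suc (Suc i)) j" | j where "v = YV j"
  by (metis var.exhaust not0_implies_Suc)

lemma collapse_add: "collapse n (d + e) = collapse n d + collapse n e"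
proof (rule poly_mapping_eqI)
  fix v
  show "lookup (collapse n (d + e)) v = lookup (collapse n d + collapse n e) v"
    by (cases v rule: var_cases) (simp_all add: lookup_collapse lookup_add sum.distrib)
qed

lemma collapse_id:
  assumes "\<And>j. lookup e (XV 1 j) = 0"
  shows "collapse n e = e"
proof (rule poly_mapping_eqI)
  fix v
  show "lookup (collapse n e) v = lookup e v"
    using assms by (cases v rule: var_cases) (simp_all add: lookup_collapse)
qed

lemma collapse_row1:
  assumes "j < n"
  shows "collapse n (term_of (XV 1 j) 1) = term_of (XV 0 j) 1 + term_of (XV 1 0) 1"
proof (rule poly_mapping_eqI)
  fix v
  show "lookup (collapse n (term_of (XV 1 j) 1)) v = lookup (term_of (XV 0 j) 1 + term_of (XV 1 0) 1) v"
    using assms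
    by (cases v rule: var_cases) (auto simp: lookup_collapse lookup_add lookup_single when_def)
qed

definition specialize :: "nat \<Rightarrow> 'k::field mpoly \<Rightarrow> 'k mpoly" where
  "specialize n = lin_ext (\<lambda>e. term_of (collapse n e) 1)"

lemma specialize_add: "specialize n (p + q) = specialize n p + specialize n q"
  by (simp add: specialize_def lin_ext_add)

lemma specialize_diff: "specialize n (p - q) = specialize n p - specialize n q"
  by (simp add: specialize_def lin_ext_diff)

lemma specialize_mult: "specialize n (p * q) = specialize n p * specialize n q"
  unfolding specialize_def by (rule lin_ext_mult) (simp add: collapse_add mult_single)

lemma specialize_sum: "specialize n (\<Sum>i\<in>A. p i) = (\<Sum>i\<in>A. specialize n (p i))"
  by (simp add: specialize_def lin_ext_sum)

lemma specialize_term: "specialize n (term_of e c) = term_of (collapse n e) c"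
  by (simp add: specialize_def mult_single)

lemma specialize_indet:
  assumes "\<And>j. v \<noteq> XV 1 j"
  shows "specialize n (indet v) = indet v"
proof -
  have "collapse n (term_of v 1) = term_of v 1"
    using assms by (intro collapse_id) (auto simp: lookup_single when_def)
  then show ?thesis by (simp add: indet_def specialize_term)
qed

lemma specialize_indet_row1:
  "j < n \<Longrightarrow> specialize n (indet (XV 1 j)) = indet (XV 1 0) * indet (XV 0 j)"
  unfolding indet_def specialize_term collapse_row1 by (simp add: mult_single add.commute)

lemma specialize_XY_entry:
  assumes "r < n" "r \<noteq> 1"
  shows "specialize n (XY_entry n r) = XY_entry n r"
  using assms by (simp add: XY_entry_eq specialize_sum specialize_mult specialize_indet)

lemma specialize_XY_entry_1:
  assumes "1 < n"
  shows "specialize n (XY_entry n 1) = indet (XV 1 0) * XY_entry n 0"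
  using assms
  by (simp add: XY_entry_eq specialize_sum specialize_mult specialize_indet
      specialize_indet_row1[simplified] sum_distrib_left mult.assoc)

definition minor2 :: "nat \<Rightarrow> nat \<Rightarrow> 'k::field mpoly" where
  "minor2 i j = indet (XV 0 i) * indet (XV 1 j) - indet (XV 0 j) * indet (XV 1 i)"

lemma specialize_minor2: "i < n \<Longrightarrow> j < n \<Longrightarrow> specialize n (minor2 i j) = 0"
  by (simp add: minor2_def specialize_diff specialize_mult specialize_indet
      specialize_indet_row1[simplified])

lemma det_2x2: "A \<in> carrier_mat 2 2 \<Longrightarrow> det A = A $$ (0, 0) * A $$ (1, 1) - A $$ (0, 1) * A $$ (1, 0)"
  using laplace_expansion_row[of A 2 0]
  by (simp add: numeral_2_eq_2 cofactor_def mat_delete_def det_single)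

lemma pick_2:
  assumes "i < (j::nat)"
  shows "pick {i, j} 0 = i" "pick {i, j} (Suc 0) = j"
proof -
  show *: "pick {i, j} 0 = i" using assms by (auto intro!: Least_equality)
  show "pick {i, j} (Suc 0) = j" using assms * by (auto intro!: Least_equality)
qed

lemma minors_first_two_rows:
  assumes "2 \<le> n"
  shows "minors 2 (first_two_rows (gen_mat n)) = {minor2 i j :: 'k::field mpoly | i j. i < j \<and> j < n}"
proof -
  let ?A = "first_two_rows (gen_mat n) :: 'k mpoly mat"
  have rows: "{i. i < n \<and> i \<in> {0, 1}} = {0, 1::nat}" using assms by auto
  have dim: "dim_row ?A = 2" "dim_col ?A = n"
    unfolding first_two_rows_def dim_submatrix by (simp_all add: gen_mat_def rows[simplified])
  have entry: "?A $$ (i, j) = indet (XV i j)" if "i < 2" "j < n" for i j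
  proof -
    have "?A $$ (i, j) = gen_mat n $$ (pick {0, 1} i, pick UNIV j)"
      unfolding first_two_rows_def
      by (rule submatrix_index) (use that rows in \<open>simp_all add: gen_mat_def\<close>)
    moreover have "pick {0, 1} i = i"
      using that pick_2[of 0 1] by (auto simp: less_2_cases_iff)
    ultimately show ?thesis
      using that assms by (simp add: pick_UNIV gen_mat_def)
  qed
  have det: "det (submatrix ?A {0, 1} {i, j}) = minor2 i j" if "i < j" "j < n" for i j
  proof -
    have I: "{a. a < dim_row ?A \<and> a \<in> {0, 1}} = {0, 1}" "{a. a < dim_col ?A \<and> a \<in> {i, j}} = {i, j}"
      using that dim by auto
    have c: "card {i, j} = 2" "card {0, 1::nat} = 2" using that by simp_all
    have "submatrix ?A {0, 1} {i, j} \<in> carrier_mat 2 2"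
      by (intro carrier_matI) (simp_all only: dim_submatrix I c)
    moreover have "submatrix ?A {0, 1} {i, j} $$ (a, b) = ?A $$ (pick {0, 1} a, pick {i, j} b)"
      if "a < 2" "b < 2" for a b
      by (rule submatrix_index) (use that in \<open>simp_all only: I c\<close>)
    ultimately show ?thesis
      using pick_2[of 0 1] pick_2[of i j] that by (simp add: det_2x2 entry minor2_def)
  qed
  show ?thesis
  proof (intro equalityI subsetI)
    fix p assume "p \<in> minors 2 ?A"
    then obtain I J where p: "p = det (submatrix ?A I J)"
      and I: "I \<subseteq> {0..<2}" "card I = 2" and J: "J \<subseteq> {0..<n}" "card J = 2"
      by (auto simp: minors_def dim)
    have "I = {0..<2}" using I by (intro card_subset_eq) auto
    then have I': "I = {0, 1}" by auto
    obtain a b where "J = {a, b}" "a \<noteq> b" using J(2) by (auto simp: card_2_iff)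
    then obtain i j where "J = {i, j}" "i < j"
      by (metis insert_commute linorder_neqE_nat)
    moreover from this have "j < n" using J(1) by simp
    ultimately show "p \<in> {minor2 i j | i j. i < j \<and> j < n}"
      using det p I' by blast
  next
    fix p :: "'k mpoly" assume "p \<in> {minor2 i j | i j. i < j \<and> j < n}"
    then obtain i j where ij: "p = minor2 i j" "i < j" "j < n" by blast
    then have "{0, 1} \<subseteq> {0..<dim_row ?A} \<and> card {0, 1::nat} = 2 \<and> {i, j} \<subseteq> {0..<dim_col ?A} \<and> card {i, j} = 2"
      by (auto simp: dim)
    then show "p \<in> minors 2 ?A"
      unfolding minors_def mem_Collect_eq using det[OF ij(2,3)] ij(1)
      by (intro exI[of _ "{0, 1}"] exI[of _ "{i, j}"]) simp
  qed
qed

section \<open>The preimage of the ideal of the remaining entries\<close>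

lemma term_carrier: "keys e \<subseteq> vars n \<Longrightarrow> term_of e c \<in> carrier (poly_ring n)"
  by (simp add: poly_ring_def)

context
  fixes J :: "'k::field mpoly set" and n :: nat
  assumes J: "ideal J (poly_ring n)"
begin

lemma ideal_poly_add: "p \<in> J \<Longrightarrow> q \<in> J \<Longrightarrow> p + q \<in> J"
  using additive_subgroup.a_closed[OF ideal.axioms(1)[OF J], of p q] by simp

lemma ideal_poly_zero: "0 \<in> J"
  using additive_subgroup.zero_closed[OF ideal.axioms(1)[OF J]] by simp

lemma ideal_poly_mult: "p \<in> J \<Longrightarrow> a \<in> carrier (poly_ring n) \<Longrightarrow> a * p \<in> J"
  using ideal.I_l_closed[OF J, of p a] by simp

lemma ideal_poly_uminus: "p \<in> J \<Longrightarrow> - p \<in> J"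
proof -
  assume "p \<in> J"
  moreover have "(- 1 :: 'k mpoly) \<in> carrier (poly_ring n)"
    by (intro carrier_closed(3)) (rule const_carrier)+
  ultimately show ?thesis using ideal_poly_mult[of p "- 1"] by simp
qed

lemma ideal_poly_diff: "p \<in> J \<Longrightarrow> q \<in> J \<Longrightarrow> p - q \<in> J"
  using ideal_poly_add[of p "- q"] ideal_poly_uminus[of q] by simp

lemma ideal_poly_sum: "(\<And>i. i \<in> A \<Longrightarrow> p i \<in> J) \<Longrightarrow> sum p A \<in> J"
  by (induction A rule: infinite_finite_induct) (simp_all add: ideal_poly_add ideal_poly_zero)

end

lemma split_var:
  fixes e :: "var \<Rightarrow>\<^sub>0 nat"
  assumes "0 < lookup e v"
  obtains d where "e = term_of v 1 + d" "keys d \<subseteq> keys e"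
proof
  show "e = term_of v 1 + (e - term_of v 1)"
    using assms
    by (intro poly_mapping_eqI) (auto simp: lookup_add lookup_minus lookup_single when_def)
  show "keys (e - term_of v 1) \<subseteq> keys e"
    by (auto simp: in_keys_iff lookup_minus)
qed

lemma keys_term_add:
  "v \<in> A \<Longrightarrow> keys d \<subseteq> A \<Longrightarrow> keys (term_of v (1::nat) + d) \<subseteq> A"
  using Poly_Mapping.keys_add[of "term_of v (1::nat)" d] by auto

text \<open>
  Induction on the degree in the variables of row 1, which is the exponent of \<open>b\<close> in the common image
  and so the same on both sides. A common factor \<open>x\<^sub>1\<^sub>j\<close> can be cancelled. If \<open>x\<^sub>1\<^sub>j\<close> divides the first
  monomial only, then the exponent of \<open>x\<^sub>0\<^sub>j\<close> in the common image shows that \<open>x\<^sub>0\<^sub>j\<close> divides the second;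
  a minor exchanges \<open>x\<^sub>1\<^sub>i x\<^sub>0\<^sub>j\<close> for \<open>x\<^sub>0\<^sub>i x\<^sub>1\<^sub>j\<close> there and creates the common factor.
\<close>

lemma collapse_eq_imp_cong:
  fixes J :: "'k::field mpoly set"
  assumes n: "2 \<le> n" and J: "ideal J (poly_ring n)"
    and minors: "\<And>i j. i < n \<Longrightarrow> j < n \<Longrightarrow> minor2 i j \<in> J"
    and d: "keys d \<subseteq> vars n" and e: "keys e \<subseteq> vars n"
    and eq: "collapse n d = collapse n e"
  shows "term_of d c - term_of e c \<in> J"
  using d e eq
proof (induction "\<Sum>j<n. lookup d (XV 1 j)" arbitrary: d e rule: less_induct)
  case less
  let ?D = "\<lambda>d. \<Sum>j<n. lookup d (XV 1 j)"
  have out: "lookup d (XV 1 j) = 0" "lookup e (XV 1 j) = 0" if "\<not> j < n" for j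
    using that less.prems(1,2) by (auto simp: vars_def in_keys_iff subset_iff)
  have DD: "?D e = ?D d"
    using arg_cong[OF less.prems(3), of "\<lambda>e. lookup e (XV 1 0)"] by (simp add: lookup_collapse)
  have common: "term_of d c - term_of e' c \<in> J"
    if j: "j < n" "0 < lookup d (XV 1 j)" "0 < lookup e' (XV 1 j)"
      and e': "keys e' \<subseteq> vars n" "collapse n d = collapse n e'" for j e'
  proof -
    obtain d0 where d0: "d = term_of (XV 1 j) 1 + d0" "keys d0 \<subseteq> keys d"
      using split_var j(2) by blast
    obtain e0 where e0: "e' = term_of (XV 1 j) 1 + e0" "keys e0 \<subseteq> keys e'"
      using split_var j(3) by blast
    have "?D d = 1 + ?D d0"
      using j(1) by (simp add: d0(1) lookup_add lookup_single when_def sum.distrib)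
    moreover have "collapse n d0 = collapse n e0"
      using e'(2) by (simp add: d0(1) e0(1) collapse_add)
    ultimately have "term_of d0 c - term_of e0 c \<in> J"
      using less.hyps[of d0 e0] less.prems(1) e'(1) d0(2) e0(2) by auto
    then have "term_of (term_of (XV 1 j) 1) 1 * (term_of d0 c - term_of e0 c) \<in> J"
      using j(1) n by (intro ideal_poly_mult[OF J] term_carrier) (auto simp: vars_def)
    then show ?thesis
      by (simp add: d0(1) e0(1) right_diff_distrib mult_single)
  qed
  show ?case
  proof (cases "?D d = 0")
    case True
    then have "lookup d (XV 1 j) = 0" "lookup e (XV 1 j) = 0" for j
      using DD out[of j] by (cases "j < n"; simp)+
    then have "collapse n d = d" "collapse n e = e"
      by (simp_all add: collapse_id)
    then have "d = e" using less.prems(3) by metis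
    then show ?thesis using ideal_poly_zero[OF J] by simp
  next
    case False
    then obtain j where j: "j < n" "0 < lookup d (XV 1 j)"
      by (metis (lifting) gr0I lessThan_iff sum.neutral)
    obtain i where i: "i < n" "0 < lookup e (XV 1 i)"
      using False DD by (metis (lifting) gr0I lessThan_iff sum.neutral)
    show ?thesis
    proof (cases "lookup e (XV 1 j) = 0")
      case False
      then show ?thesis using common j less.prems by simp
    next
      case True
      have "lookup e (XV 0 j) > 0"
        using arg_cong[OF less.prems(3), of "\<lambda>e. lookup e (XV 0 j)"] j True
        by (simp add: lookup_collapse)
      moreover obtain e0 where e0: "e = term_of (XV 1 i) 1 + e0" "keys e0 \<subseteq> keys e"
        using split_var i(2) by blast
      ultimately have "lookup e0 (XV 0 j) > 0"
        by (simp add: lookup_add lookup_single)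
      then obtain r where r: "e0 = term_of (XV 0 j) 1 + r" "keys r \<subseteq> keys e0"
        using split_var by blast
      define e' where "e' = term_of (XV 0 i) 1 + (term_of (XV 1 j) 1 + r)"
      have e: "e = term_of (XV 1 i) 1 + (term_of (XV 0 j) 1 + r)"
        using e0(1) r(1) by simp
      have rv: "keys r \<subseteq> vars n" using r(2) e0(2) less.prems(2) by blast
      have "keys e' \<subseteq> vars n"
        unfolding e'_def using rv i(1) j(1) n by (intro keys_term_add) (auto simp: vars_def)
      moreover have "collapse n e' = collapse n e"
      proof -
        have "collapse n (term_of (XV 0 l) 1) = term_of (XV 0 l) 1" for l
          by (intro collapse_id) (simp add: lookup_single)
        then show ?thesis
          by (simp only: e e'_def collapse_add collapse_row1 i(1) j(1) add_ac)
      qed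
      ultimately have "term_of d c - term_of e' c \<in> J"
        using j less.prems(3) by (intro common[of j]) (auto simp: e'_def lookup_add lookup_single)
      moreover have "term_of e' c - term_of e c \<in> J"
      proof -
        have "term_of e' c - term_of e c = term_of r c * minor2 i j"
          by (simp add: e e'_def minor2_def indet_def mult_single right_diff_distrib add_ac)
        then show ?thesis
          using ideal_poly_mult[OF J minors[OF i(1) j(1)] term_carrier[OF rv]] by simp
      qed
      ultimately show ?thesis
        using ideal_poly_add[OF J] by fastforce
    qed
  qed
qed

definition in_image :: "nat \<Rightarrow> (var \<Rightarrow>\<^sub>0 nat) \<Rightarrow> bool" where
  "in_image n e \<longleftrightarrow> (\<exists>d. keys d \<subseteq> vars n \<and> collapse n d = e)"

text \<open>
  Each factor \<open>b\<close> must be paired with a factor from row 0 to come from row 1. In this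
  numerical form the condition can be followed when variables are split off from a monomial.
\<close>

lemma in_image_iff:
  assumes "2 \<le> n"
  shows "in_image n e \<longleftrightarrow> keys e \<subseteq> vars n - {XV 1 j | j. j \<noteq> 0} \<and>
    lookup e (XV 1 0) \<le> (\<Sum>j<n. lookup e (XV 0 j))"
proof
  assume "in_image n e"
  then obtain d where d: "keys d \<subseteq> vars n" "collapse n d = e" by (auto simp: in_image_def)
  have "v \<in> vars n - {XV 1 j | j. j \<noteq> 0}" if "lookup (collapse n d) v \<noteq> 0" for v
    using that d(1) assms
    by (cases v rule: var_cases)
      (auto simp: lookup_collapse vars_def in_keys_iff subset_iff split: if_splits)
  moreover have "lookup (collapse n d) (XV 1 0) \<le> (\<Sum>j<n. lookup (collapse n d) (XV 0 j))"
    by (auto simp: lookup_collapse intro!: sum_mono)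
  ultimately show "keys e \<subseteq> vars n - {XV 1 j | j. j \<noteq> 0} \<and>
      lookup e (XV 1 0) \<le> (\<Sum>j<n. lookup e (XV 0 j))"
    unfolding d(2) by (auto simp: in_keys_iff)
next
  assume "keys e \<subseteq> vars n - {XV 1 j | j. j \<noteq> 0} \<and>
    lookup e (XV 1 0) \<le> (\<Sum>j<n. lookup e (XV 0 j))"
  then show "in_image n e"
  proof (induction "lookup e (XV 1 0)" arbitrary: e)
    case 0
    have "lookup e (XV 1 j) = 0" for j
      using 0 by (cases "j = 0") (auto simp: in_keys_iff subset_iff)
    then have "collapse n e = e" by (rule collapse_id)
    then show ?case using 0 by (auto simp: in_image_def)
  next
    case (Suc m)
    have "0 < lookup e (XV 1 0)" using Suc.hyps(2) by simp
    then obtain e1 where e1: "e = term_of (XV 1 0) 1 + e1" "keys e1 \<subseteq> keys e"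
      using split_var by blast
    have "0 < (\<Sum>j<n. lookup e (XV 0 j))" using Suc by linarith
    then obtain j where j: "j < n" "0 < lookup e (XV 0 j)"
      by (metis (lifting) gr0I lessThan_iff sum.neutral)
    then have "0 < lookup e1 (XV 0 j)"
      using e1(1) by (simp add: lookup_add lookup_single)
    then obtain e2 where e2: "e1 = term_of (XV 0 j) 1 + e2" "keys e2 \<subseteq> keys e1"
      using split_var by blast
    have e: "e = term_of (XV 1 0) 1 + (term_of (XV 0 j) 1 + e2)" using e1 e2 by simp
    have "lookup e (XV 1 0) = Suc (lookup e2 (XV 1 0))"
      by (simp add: e lookup_add lookup_single)
    moreover have "(\<Sum>l<n. lookup e (XV 0 l)) = Suc (\<Sum>l<n. lookup e2 (XV 0 l))"
      using j(1) by (simp add: e lookup_add lookup_single when_def sum.distrib)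
    ultimately have "in_image n e2"
      using Suc.hyps(2) Suc.prems e1(2) e2(2) by (intro Suc.hyps(1)) auto
    then obtain d where d: "keys d \<subseteq> vars n" "collapse n d = e2" by (auto simp: in_image_def)
    have "collapse n (term_of (XV 1 j) 1 + d) = e"
      by (simp only: collapse_add collapse_row1 j(1) d(2) e add_ac)
    moreover have "keys (term_of (XV 1 j) 1 + d) \<subseteq> vars n"
      using d(1) j(1) assms by (intro keys_term_add) (auto simp: vars_def)
    ultimately show ?case unfolding in_image_def by blast
  qed
qed

definition section_mono :: "nat \<Rightarrow> (var \<Rightarrow>\<^sub>0 nat) \<Rightarrow> 'k::field mpoly" where
  "section_mono n e =
     (if in_image n e then term_of (SOME d. keys d \<subseteq> vars n \<and> collapse n d = e) 1 else 0)"

text \<open>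
  The chosen preimage of \<open>collapse n e\<close> may differ from \<open>e\<close>, but only within its class modulo the minors.
\<close>

lemma section_specialize:
  fixes J :: "'k::field mpoly set"
  assumes n: "2 \<le> n" and J: "ideal J (poly_ring n)"
    and minors: "\<And>i j. i < n \<Longrightarrow> j < n \<Longrightarrow> minor2 i j \<in> J"
    and p: "p \<in> carrier (poly_ring n)"
  shows "p - lin_ext (section_mono n) (specialize n p) \<in> J"
proof (induction p rule: terms_induct)
  case zero
  then show ?case using ideal_poly_zero[OF J] by (simp add: specialize_def)
next
  case (monomial e c)
  then have e: "keys e \<subseteq> vars n" using p by (auto simp: poly_ring_def)
  define d where "d = (SOME d. keys d \<subseteq> vars n \<and> collapse n d = collapse n e)"
  have d: "keys d \<subseteq> vars n \<and> collapse n d = collapse n e"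
    unfolding d_def by (rule someI[of _ e]) (simp add: e)
  have "in_image n (collapse n e)" using e by (auto simp: in_image_def)
  then have "lin_ext (section_mono n) (specialize n (term_of e c)) = term_of d c"
    by (simp add: specialize_term section_mono_def d_def mult_single)
  then show ?case
    using collapse_eq_imp_cong[OF n J minors, of e d c] e d by simp
next
  case (add p q)
  then show ?case
    using ideal_poly_add[OF J add] by (simp add: specialize_add lin_ext_add algebra_simps)
qed

text \<open>
  For a monomial \<open>e\<close>, either no term of the product with the entry lies in the image, and the section
  kills it, or the product is itself the image of a multiple of an entry that belongs to \<open>J\<close>. Only for
  \<open>r = 0\<close> do the terms of the product gain a variable of row 0, so only then can \<open>e\<close> be outside the
  image; it then has one factor \<open>b\<close> in excess, and the entry to lift is that of row 1.
\<close>

lemma section_mult_XY_entry: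
  fixes J :: "'k::field mpoly set"
  assumes n: "2 \<le> n" and J: "ideal J (poly_ring n)"
    and minors: "\<And>i j. i < n \<Longrightarrow> j < n \<Longrightarrow> minor2 i j \<in> J"
    and r: "r < n" "r \<noteq> 1" and XY_r: "XY_entry n r \<in> J"
    and XY_1: "r = 0 \<Longrightarrow> XY_entry n 1 \<in> J"
  shows "lin_ext (section_mono n) (t * XY_entry n r) \<in> J"
proof (induction t rule: terms_induct)
  case zero
  then show ?case using ideal_poly_zero[OF J] by simp
next
  case (add t u)
  then show ?case
    using ideal_poly_add[OF J add] by (simp add: distrib_right lin_ext_add)
next
  case (monomial e c)
  have lift: "lin_ext (section_mono n) (specialize n (term_of d c * XY_entry n l)) \<in> J"
    if "keys d \<subseteq> vars n" "l < n" "XY_entry n l \<in> J" for d l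
  proof -
    let ?q = "term_of d c * XY_entry n l"
    have "?q \<in> J" "?q \<in> carrier (poly_ring n)"
      using that by (auto intro: ideal_poly_mult[OF J] carrier_closed term_carrier XY_entry_carrier)
    then show ?thesis
      using ideal_poly_diff[OF J _ section_specialize[OF n J minors], of ?q ?q] by simp
  qed
  let ?m = "\<lambda>s. term_of (XV r s) 1 + term_of (YV s) (1::nat)"
  consider "in_image n e" | e' where "r = 0" "e = term_of (XV 1 0) 1 + e'" "in_image n e'"
    | "\<And>s. s < n \<Longrightarrow> \<not> in_image n (e + ?m s)"
  proof (cases "\<exists>s<n. in_image n (e + ?m s)")
    case True
    then obtain s where s: "s < n" "in_image n (e + ?m s)" by blast
    have keys_e: "keys e \<subseteq> vars n - {XV 1 j | j. j \<noteq> 0}"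
      using s(2) unfolding in_image_iff[OF n] by (auto simp: subset_iff in_keys_iff lookup_add)
    have b: "lookup (e + ?m s) (XV 1 0) = lookup e (XV 1 0)"
      using r(2) by (simp add: lookup_add lookup_single when_def)
    have u: "(\<Sum>j<n. lookup (e + ?m s) (XV 0 j)) = (\<Sum>j<n. lookup e (XV 0 j)) + (if r = 0 then 1 else 0)"
      using s(1) by (simp add: lookup_add lookup_single when_def sum.distrib)
    have le: "lookup e (XV 1 0) \<le> (\<Sum>j<n. lookup e (XV 0 j)) + (if r = 0 then 1 else 0)"
      using s(2) unfolding in_image_iff[OF n] b u by simp
    show ?thesis
    proof (cases "lookup e (XV 1 0) \<le> (\<Sum>j<n. lookup e (XV 0 j))")
      case True
      then show ?thesis using keys_e that(1) in_image_iff[OF n] by blast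
    next
      case False
      then have r0: "r = 0" and eq: "lookup e (XV 1 0) = Suc (\<Sum>j<n. lookup e (XV 0 j))"
        using le by (auto split: if_splits)
      have "0 < lookup e (XV 1 0)" using eq by simp
      then obtain e' where e': "e = term_of (XV 1 0) 1 + e'" "keys e' \<subseteq> keys e"
        using split_var by blast
      have "lookup e' (XV 1 0) \<le> (\<Sum>j<n. lookup e' (XV 0 j))"
        using eq by (simp add: e'(1) lookup_add lookup_single)
      then have "in_image n e'"
        using keys_e e'(2) in_image_iff[OF n] by blast
      then show ?thesis using that(2) r0 e'(1) by blast
    qed
  next
    case False
    then show ?thesis using that(3) by blast
  qed
  then show ?case
  proof cases
    case 1
    then obtain d where d: "keys d \<subseteq> vars n" "collapse n d = e" by (auto simp: in_image_def)
    then have "specialize n (term_of d c * XY_entry n r) = term_of e c * XY_entry n r"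
      by (simp add: specialize_mult specialize_term specialize_XY_entry[OF r])
    then show ?thesis using lift[OF d(1) r(1) XY_r] by simp
  next
    case 2
    then obtain d where d: "keys d \<subseteq> vars n" "collapse n d = e'" by (auto simp: in_image_def)
    have "specialize n (term_of d c * XY_entry n 1) = term_of e' c * (indet (XV 1 0) * XY_entry n 0)"
      using n by (simp only: specialize_mult specialize_term specialize_XY_entry_1 d(2))
    also have "\<dots> = term_of e c * XY_entry n 0"
      by (simp add: 2 indet_def mult_single mult.assoc[symmetric] add.commute)
    finally have "specialize n (term_of d c * XY_entry n 1) = term_of e c * XY_entry n r"
      using 2 by simp
    moreover have "1 < n" using n by simp
    ultimately show ?thesis using lift[OF d(1) _ XY_1[OF 2(1)]] by simp
  next
    case 3
    have "term_of e c * XY_entry n r = (\<Sum>s<n. term_of (e + ?m s) c)"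
      using r(1) by (simp add: XY_entry_eq indet_def mult_single sum_distrib_left)
    moreover have "lin_ext (section_mono n) (\<Sum>s<n. term_of (e + ?m s) c) = 0"
      unfolding lin_ext_sum using 3 by (intro sum.neutral) (simp add: section_mono_def)
    ultimately show ?thesis using ideal_poly_zero[OF J] by simp
  qed
qed

lemma specialize_mem_imp_mem:
  fixes J :: "'k::field mpoly set"
  assumes k: "2 \<le> k" "k \<le> n"
    and J: "ideal J (poly_ring n)"
    and minors: "\<And>i j. i < n \<Longrightarrow> j < n \<Longrightarrow> minor2 i j \<in> J"
    and XY: "\<And>r. r < k \<Longrightarrow> XY_entry n r \<in> J"
    and p: "p \<in> carrier (poly_ring n)"
    and eq: "specialize n p = (\<Sum>i\<in>{..<k} - {1}. q i * XY_entry n i)"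
  shows "p \<in> J"
proof -
  have "lin_ext (section_mono n) (specialize n p) \<in> J"
    unfolding eq lin_ext_sum
    using k by (intro ideal_poly_sum[OF J] section_mult_XY_entry[OF _ J minors]) (auto intro: XY)
  moreover have "p - lin_ext (section_mono n) (specialize n p) \<in> J"
    using k by (intro section_specialize[OF _ J minors p]) simp_all
  ultimately show ?thesis
    using ideal_poly_add[OF J] by fastforce
qed

text \<open>
  The polynomials of the ring with this property form an ideal, so it is enough to check the generators:
  minors go to 0, and the entry of row 1 becomes a multiple of that of row 0.
\<close>

lemma mem_imp_specialize_mem:
  fixes n k :: nat and R :: "'k::field mpoly ring"
  defines "R \<equiv> poly_ring n"
  defines "J \<equiv> det_ideal R 2 (first_two_rows (gen_mat n)) <+>\<^bsub>R\<^esub> Idl\<^bsub>R\<^esub> {XY_entry n r | r. r < k}"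
  assumes k: "2 \<le> k" "k \<le> n" and p: "p \<in> J"
  shows "\<exists>q. specialize n p = (\<Sum>i\<in>{..<k} - {1}. q i * XY_entry n i)"
proof -
  interpret R: cring R unfolding R_def by (rule cring_poly_ring)
  define S where "S = {..<k} - {1}"
  define L where "L = {p \<in> carrier R. \<exists>q. specialize n p = (\<Sum>i\<in>S. q i * XY_entry n i)}"
  have mult: "a * p \<in> L" if "p \<in> L" "a \<in> carrier R" for a p
  proof -
    obtain q where "specialize n p = (\<Sum>i\<in>S. q i * XY_entry n i)"
      using \<open>p \<in> L\<close> by (auto simp: L_def)
    then have "specialize n (a * p) = (\<Sum>i\<in>S. (specialize n a * q i) * XY_entry n i)"
      by (simp add: specialize_mult sum_distrib_left mult.assoc)
    moreover have "a * p \<in> carrier R"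
      using that carrier_closed(2)[of a n p] by (simp add: L_def R_def)
    ultimately show ?thesis unfolding L_def by (auto intro: exI[of _ "\<lambda>i. specialize n a * q i"])
  qed
  have add: "a + b \<in> L" if "a \<in> L" "b \<in> L" for a b
  proof -
    obtain q where q: "specialize n a = (\<Sum>i\<in>S. q i * XY_entry n i)"
      using \<open>a \<in> L\<close> by (auto simp: L_def)
    obtain q' where q': "specialize n b = (\<Sum>i\<in>S. q' i * XY_entry n i)"
      using \<open>b \<in> L\<close> by (auto simp: L_def)
    from q q' have "specialize n (a + b) = (\<Sum>i\<in>S. (q i + q' i) * XY_entry n i)"
      by (simp add: specialize_add distrib_right sum.distrib)
    moreover have "a + b \<in> carrier R"
      using that carrier_closed(1)[of a n b] by (simp add: L_def R_def)
    ultimately show ?thesis unfolding L_def by (auto intro: exI[of _ "\<lambda>i. q i + q' i"])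
  qed
  have zero: "0 \<in> L"
    unfolding L_def using const_carrier(1)[of n]
    by (auto simp: R_def specialize_def intro: exI[of _ "\<lambda>_. 0"])
  have "ideal L R"
  proof (rule idealI)
    show "ring R" by (rule R.ring_axioms)
    show "subgroup L (add_monoid R)"
    proof (rule R.add.subgroupI)
      show "\<ominus>\<^bsub>R\<^esub> a \<in> L" if "a \<in> L" for a
      proof -
        have a: "a \<in> carrier R" using that by (simp add: L_def)
        have m1: "- 1 \<in> carrier R"
          unfolding R_def by (intro carrier_closed(3)) (rule const_carrier)+
        have "\<ominus>\<^bsub>R\<^esub> a = - a"
          using a carrier_closed(3)[of a n a] by (intro R.minus_equality) (auto simp: R_def)
        then show ?thesis using mult[OF that m1] by simp
      qed
    qed (use zero add in \<open>auto simp: L_def R_def\<close>)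
  qed (use mult in \<open>auto simp: R_def mult.commute\<close>)
  have in_L: "v \<in> L" if "v \<in> carrier R" "specialize n v = a * XY_entry n i" "i \<in> S" for v a i
  proof -
    have "specialize n v = (\<Sum>j\<in>S. if j = i then a * XY_entry n i else 0)"
      using that by (simp add: S_def)
    also have "\<dots> = (\<Sum>j\<in>S. (if j = i then a else 0) * XY_entry n j)"
      by (intro sum.cong) auto
    finally show ?thesis
      unfolding L_def using that(1) by (auto intro: exI[of _ "\<lambda>j. if j = i then a else 0"])
  qed
  have "minors 2 (first_two_rows (gen_mat n)) \<subseteq> L"
  proof
    fix m assume m: "m \<in> minors 2 (first_two_rows (gen_mat n) :: 'k mpoly mat)"
    have "2 \<le> n" using k by simp
    from m have "specialize n m = 0"
      unfolding minors_first_two_rows[OF \<open>2 \<le> n\<close>] by (auto simp: specialize_minor2)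
    moreover have "m \<in> carrier R" using m minors_carrier unfolding R_def by blast
    moreover have "0 \<in> S" using k by (simp add: S_def)
    ultimately show "m \<in> L" using in_L[of m 0 0] by simp
  qed
  then have "det_ideal R 2 (first_two_rows (gen_mat n)) \<subseteq> L"
    unfolding det_ideal_def by (rule R.genideal_minimal[OF \<open>ideal L R\<close>])
  moreover have "{XY_entry n r | r. r < k} \<subseteq> L"
  proof clarify
    fix r assume r: "r < k"
    have c: "XY_entry n r \<in> carrier R" using r k unfolding R_def by (simp add: XY_entry_carrier)
    show "XY_entry n r \<in> L"
    proof (cases "r = 1")
      case True
      have "specialize n (XY_entry n r) = indet (XV 1 0) * XY_entry n 0"
        unfolding True by (rule specialize_XY_entry_1) (use k in simp)
      then show ?thesis using k by (intro in_L[OF c]) (auto simp: S_def)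
    next
      case False
      then have "specialize n (XY_entry n r) = 1 * XY_entry n r"
        using k r by (simp add: specialize_XY_entry)
      then show ?thesis using r False by (intro in_L[OF c, of 1 r]) (auto simp: S_def)
    qed
  qed
  then have "Idl\<^bsub>R\<^esub> {XY_entry n r | r. r < k} \<subseteq> L"
    by (rule R.genideal_minimal[OF \<open>ideal L R\<close>])
  ultimately have "J \<subseteq> L"
    unfolding J_def set_add_def' using add by (auto simp: R_def)
  then show ?thesis using p by (auto simp: L_def S_def)
qed

section \<open>Transversality\<close>

theorem lemma7p4:
  fixes n k :: nat and R :: "'k::field mpoly ring"
  assumes "n \<ge> 2" and "2 \<le> k" and "k \<le> n - 1"
  defines "R \<equiv> poly_ring n"
  defines "J \<equiv> det_ideal R 2 (first_two_rows (gen_mat n)) <+>\<^bsub>R\<^esub> Idl\<^bsub>R\<^esub> {XY_entry n r | r. r < k}"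
  shows "J \<inter> Idl\<^bsub>R\<^esub> {XY_entry n k} = ideal_prod R J (Idl\<^bsub>R\<^esub> {XY_entry n k})"
proof -
  interpret R: cring R unfolding R_def by (rule cring_poly_ring)
  let ?I = "det_ideal R 2 (first_two_rows (gen_mat n))"
  let ?G = "Idl\<^bsub>R\<^esub> {XY_entry n r | r. r < k}"
  let ?g = "XY_entry n k :: 'k mpoly"
  have kn: "k < n" "k \<le> n" using assms(1,3) by simp_all
  have XY_carrier: "XY_entry n r \<in> carrier R" if "r < n" for r
    unfolding R_def by (rule XY_entry_carrier[OF that])
  have minors_sub: "minors 2 (first_two_rows (gen_mat n)) \<subseteq> carrier R"
    unfolding R_def by (rule minors_carrier)
  have XYs_sub: "{XY_entry n r | r. r < k} \<subseteq> carrier R"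
    using XY_carrier kn by auto
  have I: "ideal ?I R" and G: "ideal ?G R"
    unfolding det_ideal_def using minors_sub XYs_sub by (auto intro!: R.genideal_ideal)
  have J: "ideal J R"
    unfolding J_def by (rule R.add_ideals[OF I G])
  have zero: "0 \<in> ?I" "0 \<in> ?G"
    using ideal_poly_zero I G unfolding R_def by blast+
  have "?I \<subseteq> J" "?G \<subseteq> J"
    unfolding J_def set_add_def' using zero by (force simp: R_def)+
  then have "minors 2 (first_two_rows (gen_mat n)) \<subseteq> J" and XY: "\<And>r. r < k \<Longrightarrow> XY_entry n r \<in> J"
    using R.genideal_self[OF minors_sub] R.genideal_self[OF XYs_sub] unfolding det_ideal_def by blast+
  then have lt: "minor2 i j \<in> J" if "i < j" "j < n" for i j
    using that minors_first_two_rows[OF assms(1)] by blast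
  have minors: "minor2 i j \<in> J" if "i < n" "j < n" for i j
  proof (cases i j rule: linorder_cases)
    case equal
    then show ?thesis using ideal_poly_zero J unfolding R_def by (simp add: minor2_def)
  next
    case greater
    then have "- minor2 j i \<in> J" using lt that ideal_poly_uminus J unfolding R_def by blast
    then show ?thesis by (simp add: minor2_def)
  qed (use lt that in blast)
  have cancel: "p \<in> J" if p: "p \<in> carrier R" "p * ?g \<in> J" for p
  proof -
    obtain q where "specialize n (p * ?g) = (\<Sum>i\<in>{..<k} - {1}. q i * XY_entry n i)"
      using mem_imp_specialize_mem[OF assms(2) kn(2), of "p * ?g"] p(2)
      unfolding J_def R_def by blast
    then have "specialize n p * ?g = (\<Sum>i\<in>{..<k} - {1}. q i * XY_entry n i)"
      using assms(2) kn by (simp add: specialize_mult specialize_XY_entry)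
    then obtain q' where "specialize n p = (\<Sum>i\<in>{..<k} - {1}. q' i * XY_entry n i)"
      using kn by (elim XY_entries_regular[rotated 3]) auto
    then show ?thesis
      using p(1) J unfolding R_def
      by (intro specialize_mem_imp_mem[OF assms(2) kn(2) _ minors XY])
  qed
  have g: "?g \<in> carrier R" by (rule XY_carrier[OF kn(1)])
  have gI: "ideal (Idl\<^bsub>R\<^esub> {?g}) R" using g by (intro R.genideal_ideal) simp
  show ?thesis
  proof
    show "ideal_prod R J (Idl\<^bsub>R\<^esub> {?g}) \<subseteq> J \<inter> Idl\<^bsub>R\<^esub> {?g}"
      by (rule R.ideal_prod_inter[OF J gI])
    show "J \<inter> Idl\<^bsub>R\<^esub> {?g} \<subseteq> ideal_prod R J (Idl\<^bsub>R\<^esub> {?g})"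
    proof
      fix z assume z: "z \<in> J \<inter> Idl\<^bsub>R\<^esub> {?g}"
      then have "z \<in> PIdl\<^bsub>R\<^esub> ?g" using R.cgenideal_eq_genideal[OF g] by simp
      then obtain p where p: "p \<in> carrier R" "z = p \<otimes>\<^bsub>R\<^esub> ?g" by (auto simp: cgenideal_def)
      then have "p \<in> J" using z cancel by (simp add: R_def)
      moreover have "?g \<in> Idl\<^bsub>R\<^esub> {?g}" using R.genideal_self'[OF g] .
      ultimately show "z \<in> ideal_prod R J (Idl\<^bsub>R\<^esub> {?g})"
        unfolding p(2) by (rule ideal_prod.prod)
    qed
  qed
qed

end
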